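(* Suppose objective smoothing is used, the feasibility and regularity assumptions stated in the context hold, and the two-stage decomposition algorithm described in the context generates a sequence of iterates $\{u^l\}$ with corresponding subproblem solutions $\{v_i^l\}$, $i=1,\dots,N$. Let $(u^*,v_1^*,\dots,v_N^* )$ be a limit point of $\{(u^l,v_1^l,\dots,v_N^l)\}$. Then $(x^*,y_1^*,\dots,y_N^* )$ is a KKT point of the undecomposed problem $$\min_{x,\{y_i\}} f_0(x)+\sum_{i=1}^Nf_i(y_i;x)\quad\text{s.t.}\quad c_0(x)\le0,\quad c_i(y_i;x)\le0,\ i=1,\dots,N,$$ where $x^*$ and $y_i^*$ are the corresponding subvectors of $u^*$ and $v_i^*$.
   Context: Two-stage problem: the first stage is $\min_{x\in\mathbb{R}^{n_0}} f_0(x)+\sum_{i=1}^N\hat f_i(x)$ subject to $c_0(x)\le 0$; the $i$-th second-stage problem (subproblem) parameterized by $x$ is $\min_{y_i\in\mathbb{R}^{n_i}} f_i(y_i;x)$ subject to $c_i(y_i;x)\le 0$, with $f_i:\mathbb{R}^{n_i}\times\mathbb{R}^{n_0}\to\mathbb{R}$ and $c_i:\mathbb{R}^{n_i}\times\mathbb{R}^{n_0}\to\mathbb{R}^{m_i}$, not necessarily convex. For a smoothing parameter $\mu>0$, objective smoothing replaces $\hat f_i(x)$ by the (local) optimal value $\hat f_i(x;\mu)$ of $$\min_{y_i,s_i,\tilde x_i} f_i(y_i;\tilde x_i)-\mu\sum_j\ln(s_{ij})\quad\text{s.t.}\quad c_i(y_i;\tilde x_i)+s_i=0\ [\lambda_i],\quad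 \tilde x_i-x=0\ [\eta_i],$$ with multipliers in brackets. Let $v_i=(y_i,\tilde x_i,s_i,\lambda_i,\eta_i)$, $\mathcal{L}_i=f_i(y_i;\tilde x_i)+(c_i(y_i;\tilde x_i)+s_i)^T\lambda_i+(\tilde x_i-x)^T\eta_i$, and $$F_i(v_i;x,\mu)=\big(\nabla_{y_i}\mathcal{L}_i,\ \nabla_{\tilde x_i}\mathcal{L}_i,\ s_i\circ\lambda_i-\mu e,\ c_i(y_i;\tilde x_i)+s_i,\ \tilde x_i-x\big),$$ where $\circ$ is the componentwise product and $e$ the all-ones vector. The subproblem solver, given $x$ and $\mu$, returns a KKT point $v_i$, i.e. $F_i(v_i;x,\mu)=0$ with $s_i,\lambda_i>0$, and the gradient reported to the first stage is $\nabla_x\hat f_i(x;\mu)=-\eta_i$. First-stage variables: $u=(x,s_0,\lambda_0)$ with slack $s_0\ge0$ and multipliers $\lambda_0\ge0$ for $c_0(x)\le0$. Optimality measure: $\theta_0(u;\mu)=\|F_0(u;\mu)\|$ with $$F_0(u;\mu)=\Big(\nabla f_0(x)+\sum_{i=1}^N\nabla_x\hat f_i(x;\mu)+\nabla c_0(x)\lambda_0,\ c_0(x)+s_0,\ s_0\circ\lambda_0\Big),$$ where $\nabla c_0(x)$ is the transposed Jacobian. Two-stage decomposition algorithm: given $\tilde u^0$, $\mu^0>0$, and a constant $\bar c>0$; for $l=0,1,2,\dots$: starting from $\tilde u^l$, a first-stage solver finds $u^l=(x^l,s_0^l,\lambda_0^l)$ with $\theta_0(u^l;\mu^l)\le\bar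 c\,\mu^l$; let $v_i^l$ be the primal-dual subproblem solution (KKT point for $x^l$, $\mu^l$) returned by the subproblem solver at $x^l$, from which $\nabla_x\hat f_i(x^l;\mu^l)=-\eta_i^l$ is computed; choose $\mu^{l+1}\in(0,\mu^l)$ so that $\mu^l\to0$; choose a starting iterate $\tilde u^{l+1}$. Feasibility assumption: for any $x$ sent to the subproblems by the first-stage problem, the subproblem parameterized by $x$ is feasible and the subproblem solver always returns a KKT point. Regularity assumption (objective smoothing): $f_0,c_0$ are $C^1$ with locally Lipschitz continuous first derivatives; $f_i(\cdot;\cdot)$ and $c_i(\cdot;\cdot)$ are $C^2$ with locally Lipschitz continuous second derivatives. KKT point of the undecomposed problem: a feasible $(x,y_1,\dots,y_N)$ for which there are multipliers $\lambda_0\ge0$, $\lambda_i\ge0$, complementary to $c_0(x)\le0$ and $c_i(y_i;x)\le0$, such that $\nabla f_0(x)+\nabla c_0(x)\lambda_0+\sum_i[\nabla_xf_i(y_i;x)+\nabla_xc_i(y_i;x)\lambda_i]=0$ and $\nabla_{y_i}f_i(y_i;x)+\nabla_{y_i}c_i(y_i;x)\lambda_i=0$ for all $i$. *)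

theory Defs
  imports "HOL-Analysis.Analysis"
begin

(* The dimensions n_i and m_i differ from one subproblem to the next, so they cannot all be the
   size of one index type.  R^{n_i} is the coordinate subspace of real^'y spanned by the
   coordinates in a set J_i with n_i = card J_i, and R^{m_i} that of real^'m for a set K_i with
   m_i = card K_i.  As 'y and 'm are arbitrary finite types, every family of dimensions occurs.
   A function on R^{n_i} x R^{n_0} is given as a function on real^'y x real^'x that reads only the
   coordinates of y in J_i; its partial derivatives along the other coordinates are then zero, so
   differentiability, smoothness and gradients agree with those of the original function. *)

definition coord_space :: "'a::finite set \<Rightarrow> (real^'a) set" where
  "coord_space A = {v. \<forall>j. j \<notin> A \<longrightarrow> v $ j = 0}"

definition reads_only :: "'y::finite set \<Rightarrow> ((real^'y) \<times> 'x \<Rightarrow> 'b) \<Rightarrow> bool" where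
  "reads_only A h \<longleftrightarrow> (\<forall>y y' x. (\<forall>j\<in>A. y $ j = y' $ j) \<longrightarrow> h (y, x) = h (y', x))"

definition subproblem_functions ::
  "'y::finite set \<Rightarrow> 'm::finite set \<Rightarrow> ((real^'y) \<times> (real^'x::finite) \<Rightarrow> real)
    \<Rightarrow> ((real^'y) \<times> (real^'x) \<Rightarrow> real^'m) \<Rightarrow> bool" where
  "subproblem_functions J K f c \<longleftrightarrow>
     reads_only J f \<and> reads_only J c \<and> (\<forall>z. c z \<in> coord_space K)"

definition gradient :: "('a::real_inner \<Rightarrow> real) \<Rightarrow> 'a \<Rightarrow> 'a" where
  "gradient h x = (THE D. GDERIV h x :> D)"

(* The transposed Jacobian. *)
definition nabla :: "(real^'a::finite \<Rightarrow> real^'b::finite) \<Rightarrow> real^'a \<Rightarrow> real^'b^'a" where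
  "nabla h x = transpose (jacobian h (at x))"

definition locally_lipschitz :: "('a::metric_space \<Rightarrow> 'b::metric_space) \<Rightarrow> bool" where
  "locally_lipschitz h \<longleftrightarrow> (\<forall>x. \<exists>r>0. \<exists>L. L-lipschitz_on (ball x r) h)"

(* Continuity of the top-order derivative is implied by its local Lipschitz continuity. *)
definition C1_lipschitz :: "('a::real_normed_vector \<Rightarrow> 'b::real_normed_vector) \<Rightarrow> bool" where
  "C1_lipschitz h \<longleftrightarrow>
     (\<exists>h' :: 'a \<Rightarrow> 'a \<Rightarrow>\<^sub>L 'b. (\<forall>x. (h has_derivative blinfun_apply (h' x)) (at x)) \<and> locally_lipschitz h')"

definition C2_lipschitz :: "('a::real_normed_vector \<Rightarrow> 'b::real_normed_vector) \<Rightarrow> bool" where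
  "C2_lipschitz h \<longleftrightarrow>
     (\<exists>h' :: 'a \<Rightarrow> 'a \<Rightarrow>\<^sub>L 'b. (\<forall>x. (h has_derivative blinfun_apply (h' x)) (at x)) \<and> C1_lipschitz h')"

definition is_limit_point :: "(nat \<Rightarrow> 'a::topological_space) \<Rightarrow> 'a \<Rightarrow> bool" where
  "is_limit_point X z \<longleftrightarrow> (\<exists>r :: nat \<Rightarrow> nat. strict_mono r \<and> (X \<circ> r) \<longlonglongrightarrow> z)"

(* v_i = (y_i, tilde x_i, s_i, lambda_i, eta_i) *)
type_synonym ('y, 'x, 'm) subvar =
  "(real^'y) \<times> (real^'x) \<times> (real^'m) \<times> (real^'m) \<times> (real^'x)"

(* u = (x, s_0, lambda_0) *)
type_synonym ('x, 'k) firstvar = "(real^'x) \<times> (real^'k) \<times> (real^'k)"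

definition sub_lagrangian ::
  "((real^'y::finite) \<times> (real^'x::finite) \<Rightarrow> real) \<Rightarrow> ((real^'y) \<times> (real^'x) \<Rightarrow> real^'m::finite)
    \<Rightarrow> real^'x \<Rightarrow> ('y, 'x, 'm) subvar \<Rightarrow> real" where
  "sub_lagrangian f c x v = (case v of (y, xt, s, lam, eta) \<Rightarrow>
     f (y, xt) + (c (y, xt) + s) \<bullet> lam + (xt - x) \<bullet> eta)"

(* Multiplication of vectors of type real^'m is the componentwise product.  The all-ones vector
   of R^{m_i} is the indicator of K_i. *)
definition sub_F ::
  "'m::finite set \<Rightarrow> ((real^'y::finite) \<times> (real^'x::finite) \<Rightarrow> real)
    \<Rightarrow> ((real^'y) \<times> (real^'x) \<Rightarrow> real^'m) \<Rightarrow> ('y, 'x, 'm) subvar \<Rightarrow> real^'x \<Rightarrow> real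
    \<Rightarrow> (real^'y) \<times> (real^'x) \<times> (real^'m) \<times> (real^'m) \<times> (real^'x)" where
  "sub_F K f c v x \<mu> = (case v of (y, xt, s, lam, eta) \<Rightarrow>
     (gradient (\<lambda>y'. sub_lagrangian f c x (y', xt, s, lam, eta)) y,
      gradient (\<lambda>xt'. sub_lagrangian f c x (y, xt', s, lam, eta)) xt,
      s * lam - \<mu> *\<^sub>R (\<chi> j. if j \<in> K then 1 else 0),
      c (y, xt) + s,
      xt - x))"

definition sub_kkt ::
  "'y::finite set \<Rightarrow> 'm::finite set \<Rightarrow> ((real^'y) \<times> (real^'x::finite) \<Rightarrow> real)
    \<Rightarrow> ((real^'y) \<times> (real^'x) \<Rightarrow> real^'m) \<Rightarrow> real^'x \<Rightarrow> real \<Rightarrow> ('y, 'x, 'm) subvar \<Rightarrow> bool" where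
  "sub_kkt J K f c x \<mu> v \<longleftrightarrow> (case v of (y, xt, s, lam, eta) \<Rightarrow>
     y \<in> coord_space J \<and> s \<in> coord_space K \<and> lam \<in> coord_space K \<and>
     sub_F K f c v x \<mu> = 0 \<and> (\<forall>j\<in>K. s $ j > 0 \<and> lam $ j > 0))"

definition sub_feasible ::
  "'y::finite set \<Rightarrow> ((real^'y) \<times> (real^'x::finite) \<Rightarrow> real^'m::finite) \<Rightarrow> real^'x \<Rightarrow> bool" where
  "sub_feasible J c x \<longleftrightarrow> (\<exists>y\<in>coord_space J. c (y, x) \<le> 0)"

(* The gradient -eta_i that the subproblem solver S, run on x and mu, reports to the first stage. *)
definition reported_gradient ::
  "(real^'x::finite \<Rightarrow> real \<Rightarrow> ('y::finite, 'x, 'm::finite) subvar) \<Rightarrow> real^'x \<Rightarrow> real \<Rightarrow> real^'x" where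
  "reported_gradient S x \<mu> = (case S x \<mu> of (y, xt, s, lam, eta) \<Rightarrow> - eta)"

definition first_F ::
  "(real^'x::finite \<Rightarrow> real) \<Rightarrow> (real^'x \<Rightarrow> real^'k::finite)
    \<Rightarrow> ('i::finite \<Rightarrow> real^'x \<Rightarrow> real \<Rightarrow> ('y::finite, 'x, 'm::finite) subvar)
    \<Rightarrow> ('x, 'k) firstvar \<Rightarrow> real \<Rightarrow> (real^'x) \<times> (real^'k) \<times> (real^'k)" where
  "first_F f0 c0 S u \<mu> = (case u of (x, s0, lam0) \<Rightarrow>
     (gradient f0 x + (\<Sum>i\<in>UNIV. reported_gradient (S i) x \<mu>) + nabla c0 x *v lam0,
      c0 x + s0,
      s0 * lam0))"

definition first_theta ::
  "(real^'x::finite \<Rightarrow> real) \<Rightarrow> (real^'x \<Rightarrow> real^'k::finite)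
    \<Rightarrow> ('i::finite \<Rightarrow> real^'x \<Rightarrow> real \<Rightarrow> ('y::finite, 'x, 'm::finite) subvar)
    \<Rightarrow> ('x, 'k) firstvar \<Rightarrow> real \<Rightarrow> real" where
  "first_theta f0 c0 S u \<mu> = norm (first_F f0 c0 S u \<mu>)"

(* A run of the algorithm.  S i is the solver of the i-th subproblem, FS the first-stage solver
   (called with a starting iterate and mu), ut the starting iterates, and sent l the set of all
   first-stage points sent to the subproblems in iteration l.  Since the values mu l are pairwise
   distinct, taking the solvers to be functions of their input is no restriction on which
   u l and v l can occur. *)
definition two_stage_run ::
  "(real^'x::finite \<Rightarrow> real) \<Rightarrow> (real^'x \<Rightarrow> real^'k::finite)
    \<Rightarrow> ('i::finite \<Rightarrow> real^'x \<Rightarrow> real \<Rightarrow> ('y::finite, 'x, 'm::finite) subvar)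
    \<Rightarrow> (('x, 'k) firstvar \<Rightarrow> real \<Rightarrow> ('x, 'k) firstvar)
    \<Rightarrow> real \<Rightarrow> (nat \<Rightarrow> real) \<Rightarrow> (nat \<Rightarrow> ('x, 'k) firstvar) \<Rightarrow> (nat \<Rightarrow> (real^'x) set)
    \<Rightarrow> (nat \<Rightarrow> ('x, 'k) firstvar) \<Rightarrow> (nat \<Rightarrow> ('y, 'x, 'm) subvar ^ 'i) \<Rightarrow> bool" where
  "two_stage_run f0 c0 S FS cbar \<mu> ut sent u v \<longleftrightarrow>
     cbar > 0 \<and> \<mu> 0 > 0 \<and> (\<forall>l. 0 < \<mu> (Suc l) \<and> \<mu> (Suc l) < \<mu> l) \<and> \<mu> \<longlonglongrightarrow> 0 \<and>
     (\<forall>l. u l = FS (ut l) (\<mu> l) \<and>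
          (case u l of (x, s0, lam0) \<Rightarrow>
             s0 \<ge> 0 \<and> lam0 \<ge> 0 \<and> x \<in> sent l \<and> (\<forall>i. v l $ i = S i x (\<mu> l))) \<and>
          first_theta f0 c0 S (u l) (\<mu> l) \<le> cbar * \<mu> l)"

definition undecomposed_kkt ::
  "('i::finite \<Rightarrow> 'y::finite set) \<Rightarrow> ('i \<Rightarrow> 'm::finite set)
    \<Rightarrow> (real^'x::finite \<Rightarrow> real) \<Rightarrow> (real^'x \<Rightarrow> real^'k::finite)
    \<Rightarrow> ('i \<Rightarrow> (real^'y) \<times> (real^'x) \<Rightarrow> real) \<Rightarrow> ('i \<Rightarrow> (real^'y) \<times> (real^'x) \<Rightarrow> real^'m)
    \<Rightarrow> real^'x \<Rightarrow> ('i \<Rightarrow> real^'y) \<Rightarrow> bool" where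
  "undecomposed_kkt J K f0 c0 f c x y \<longleftrightarrow>
     (\<forall>i. y i \<in> coord_space (J i)) \<and>
     c0 x \<le> 0 \<and> (\<forall>i. c i (y i, x) \<le> 0) \<and>
     (\<exists>(lam0 :: real^'k) (lam :: 'i \<Rightarrow> real^'m).
        lam0 \<ge> 0 \<and> c0 x * lam0 = 0 \<and>
        (\<forall>i. lam i \<in> coord_space (K i) \<and> lam i \<ge> 0 \<and> c i (y i, x) * lam i = 0) \<and>
        gradient f0 x + nabla c0 x *v lam0
          + (\<Sum>i\<in>UNIV. gradient (\<lambda>x'. f i (y i, x')) x
                       + nabla (\<lambda>x'. c i (y i, x')) x *v lam i) = 0 \<and>
        (\<forall>i. gradient (\<lambda>y'. f i (y', x)) (y i)
             + nabla (\<lambda>y'. c i (y', x)) (y i) *v lam i = 0))"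

end

theory Submission
  imports Defs
begin

text \<open>
  Everything is a passage to the limit in a perturbed optimality system. In a subproblem solution
  the copy \<open>xt\<close> of the first-stage variable equals \<open>x\<close>, and the second
  stationarity equation determines the multiplier \<open>\<eta>\<close> of the coupling constraint:
  \<open>- \<eta>\<close> is the gradient in \<open>x\<close> of the subproblem objective plus the
  multiplier-weighted constraints (lemma \<open>sub_kkt_system\<close>). Hence the gradient reported to
  the first stage is exactly the \<open>i\<close>-th summand of the stationarity equation of the
  undecomposed problem, and \<open>first_theta \<le> cbar * \<mu>\<close> says that the iterates solve
  the whole undecomposed KKT system up to a residual that vanishes with \<open>\<mu>\<close>.

  Each part of the system survives the limit. The derivatives are continuous, so the stationarity
  equations do (lemmas \<open>gradient_tendsto\<close> and \<open>nabla_mult_tendsto\<close>). The products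
  of slacks and multipliers tend to zero: in a subproblem they are \<open>\<mu>\<close> on the constraint
  coordinates, and in the first stage they are part of the residual. So complementarity holds
  with the limits of the multipliers, which exist because the multipliers are components of the
  convergent sequence (lemmas \<open>feasibility_complementarity_limit\<close> and
  \<open>sub_kkt_limit\<close>).
\<close>

section \<open>Gradients and transposed Jacobians as limits\<close>

text \<open>
  Gradients and transposed Jacobians enter the optimality system as vectors, while the regularity
  assumption provides derivatives as linear maps. Testing a vector against all directions
  translates between the two.
\<close>

lemma gradient_inner:
  fixes h :: "'a::euclidean_space \<Rightarrow> real"
  assumes "(h has_derivative h') (at x)"
  shows "gradient h x \<bullet> d = h' d"
proof -
  have lin: "linear h'"
    using assms by (rule has_derivative_linear)
  define D where "D = (\<Sum>b\<in>Basis. h' b *\<^sub>R b)"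
  have D: "h' = (\<lambda>d. d \<bullet> D)"
  proof
    fix d
    have "h' d = h' (\<Sum>b\<in>Basis. (d \<bullet> b) *\<^sub>R b)"
      by (simp add: euclidean_representation)
    also have "\<dots> = d \<bullet> D"
      by (simp add: D_def linear_sum[OF lin] linear_cmul[OF lin] inner_sum_right mult.commute)
    finally show "h' d = d \<bullet> D" .
  qed
  have "gradient h x = D"
    unfolding gradient_def
  proof (rule the_equality)
    show "GDERIV h x :> D"
      using assms D by (simp add: gderiv_def)
    fix E
    assume "GDERIV h x :> E"
    then have "(\<lambda>d. d \<bullet> E) = (\<lambda>d. d \<bullet> D)"
      using has_derivative_unique[OF _ assms] by (simp add: gderiv_def D)
    then have "\<forall>d. d \<bullet> E = d \<bullet> D"
      by (simp add: fun_eq_iff)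
    then show "E = D"
      by (rule vector_eq_ldot[THEN iffD1])
  qed
  then show ?thesis
    by (simp add: D inner_commute)
qed

lemma nabla_mult_inner:
  fixes h :: "real^'a::finite \<Rightarrow> real^'b::finite"
  assumes "(h has_derivative h') (at x)"
  shows "(nabla h x *v lam) \<bullet> d = lam \<bullet> h' d"
proof -
  have "h' = (*v) (jacobian h (at x))"
    using assms jacobian_works differentiableI has_derivative_unique by metis
  then show ?thesis
    by (simp add: nabla_def transpose_matrix_vector dot_lmul_matrix)
qed

lemma gradient_tendsto:
  fixes h :: "'a::euclidean_space \<Rightarrow> real"
  assumes "\<And>n. (hs n has_derivative hs' n) (at (xs n))" "(h has_derivative h') (at x)"
    and "\<And>d. (\<lambda>n. hs' n d) \<longlonglongrightarrow> h' d"
  shows "(\<lambda>n. gradient (hs n) (xs n)) \<longlonglongrightarrow> gradient h x"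
  unfolding tendsto_componentwise_iff[of _ "gradient h x"]
    gradient_inner[OF assms(1)] gradient_inner[OF assms(2)]
  using assms(3) by blast

lemma nabla_mult_tendsto:
  fixes h :: "real^'a::finite \<Rightarrow> real^'b::finite"
  assumes "\<And>n. (hs n has_derivative hs' n) (at (xs n))" "(h has_derivative h') (at x)"
    and "\<And>d. (\<lambda>n. hs' n d) \<longlonglongrightarrow> h' d" and "lams \<longlonglongrightarrow> lam"
  shows "(\<lambda>n. nabla (hs n) (xs n) *v lams n) \<longlonglongrightarrow> nabla h x *v lam"
  unfolding tendsto_componentwise_iff[of _ "nabla h x *v lam"]
    nabla_mult_inner[OF assms(1)] nabla_mult_inner[OF assms(2)]
  using assms(3,4) by (intro ballI tendsto_inner)

section \<open>What the regularity assumption provides\<close>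

text \<open>
  Continuity of the derivative is what lets the stationarity equations pass to the limit. It is
  extracted from both smoothness classes in the same form, so that the two stages can be treated
  alike.
\<close>

lemma locally_lipschitz_imp_continuous:
  assumes "locally_lipschitz h"
  shows "isCont h x"
proof -
  obtain r L where "r > 0" "L-lipschitz_on (ball x r) h"
    using assms unfolding locally_lipschitz_def by blast
  then show ?thesis
    using lipschitz_on_continuous_on continuous_on_eq_continuous_at centre_in_ball open_ball
    by blast
qed

lemma C1_lipschitz_imp_C1:
  assumes "C1_lipschitz h"
  obtains h' :: "'a::real_normed_vector \<Rightarrow> 'a \<Rightarrow>\<^sub>L 'b::real_normed_vector"
  where "\<And>x. (h has_derivative blinfun_apply (h' x)) (at x)" "\<And>x. isCont h' x"
proof -
  obtain h' where "\<forall>x. (h has_derivative blinfun_apply (h' x)) (at x)" "locally_lipschitz h'"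
    using assms unfolding C1_lipschitz_def by auto
  then show ?thesis
    using that[of h'] locally_lipschitz_imp_continuous[of h'] by simp
qed

lemma C1_lipschitz_imp_continuous:
  assumes "C1_lipschitz h"
  shows "isCont h x"
  by (rule C1_lipschitz_imp_C1[OF assms]) (rule has_derivative_continuous)

lemma C2_lipschitz_imp_C1:
  assumes "C2_lipschitz h"
  obtains h' :: "'a::real_normed_vector \<Rightarrow> 'a \<Rightarrow>\<^sub>L 'b::real_normed_vector"
  where "\<And>x. (h has_derivative blinfun_apply (h' x)) (at x)" "\<And>x. isCont h' x"
proof -
  obtain h' where "\<forall>x. (h has_derivative blinfun_apply (h' x)) (at x)" "C1_lipschitz h'"
    using assms unfolding C2_lipschitz_def by auto
  then show ?thesis
    using that[of h'] C1_lipschitz_imp_continuous[of h'] by simp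
qed

lemma partial_derivatives:
  assumes "(h has_derivative h') (at (y, x))"
  shows "((\<lambda>y'. h (y', x)) has_derivative (\<lambda>d. h' (d, 0))) (at y)"
    and "((\<lambda>x'. h (y, x')) has_derivative (\<lambda>d. h' (0, d))) (at x)"
proof -
  have "((\<lambda>y'. (y', x)) has_derivative (\<lambda>d. (d, 0))) (at y)"
    "((\<lambda>x'. (y, x')) has_derivative (\<lambda>d. (0, d))) (at x)"
    by (auto intro!: derivative_eq_intros)
  then show "((\<lambda>y'. h (y', x)) has_derivative (\<lambda>d. h' (d, 0))) (at y)"
    "((\<lambda>x'. h (y, x')) has_derivative (\<lambda>d. h' (0, d))) (at x)"
    using assms has_derivative_compose by fastforce+
qed

section \<open>The optimality system of a subproblem\<close>

text \<open>
  Both blocks of the gradient of the Lagrangian have this shape: an objective, a constraint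
  weighted by multipliers, and a linear coupling term with gradient \<open>a\<close>, which is
  \<open>\<eta>\<close> for the block of \<open>xt\<close> and zero for that of \<open>y\<close>.
\<close>

lemma gradient_lagrangian:
  fixes h :: "real^'a::finite \<Rightarrow> real" and g :: "real^'a \<Rightarrow> real^'b::finite"
  assumes h: "(h has_derivative h') (at z)" and g: "(g has_derivative g') (at z)"
  shows "gradient (\<lambda>z'. h z' + (g z' + s) \<bullet> lam + (z' - p) \<bullet> a) z
    = gradient h z + nabla g z *v lam + a"
proof (subst vector_eq_rdot[symmetric], rule allI)
  fix d
  have "((\<lambda>z'. h z' + (g z' + s) \<bullet> lam + (z' - p) \<bullet> a) has_derivative
      (\<lambda>d. h' d + g' d \<bullet> lam + d \<bullet> a)) (at z)"
    by (auto intro!: derivative_eq_intros h g)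
  from gradient_inner[OF this]
  show "gradient (\<lambda>z'. h z' + (g z' + s) \<bullet> lam + (z' - p) \<bullet> a) z \<bullet> d
    = (gradient h z + nabla g z *v lam + a) \<bullet> d"
    using gradient_inner[OF h, of d] nabla_mult_inner[OF g, of lam d]
    by (simp add: inner_add_left) (simp add: inner_commute)
qed

text \<open>
  The subproblem is differentiated in the copy \<open>xt\<close> of \<open>x\<close>, so that the
  multiplier \<open>\<eta>\<close> of \<open>xt - x = 0\<close> absorbs the sensitivity of the
  subproblem with respect to \<open>x\<close>. This makes the last conclusion an equation between the
  reported gradient \<open>- \<eta>\<close> and the summand of the undecomposed stationarity equation.
\<close>

lemma sub_kkt_system:
  assumes kkt: "sub_kkt J K f c x \<mu> (y, xt, s, lam, eta)"
    and f: "\<And>z. (f has_derivative blinfun_apply (f' z)) (at z)"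
    and c: "\<And>z. (c has_derivative blinfun_apply (c' z)) (at z)"
  shows "y \<in> coord_space J" "lam \<in> coord_space K" "lam \<ge> 0" "s \<ge> 0"
    and "c (y, x) + s = 0"
    and "s * lam = \<mu> *\<^sub>R (\<chi> j. if j \<in> K then 1 else 0)"
    and "gradient (\<lambda>y'. f (y', x)) y + nabla (\<lambda>y'. c (y', x)) y *v lam = 0"
    and "gradient (\<lambda>x'. f (y, x')) x + nabla (\<lambda>x'. c (y, x')) x *v lam = - eta"
proof -
  have xt: "xt = x"
    using kkt by (simp add: sub_kkt_def sub_F_def zero_prod_def)
  show "y \<in> coord_space J" "lam \<in> coord_space K"
    using kkt by (auto simp: sub_kkt_def)
  show "c (y, x) + s = 0" "s * lam = \<mu> *\<^sub>R (\<chi> j. if j \<in> K then 1 else 0)"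
    using kkt by (auto simp: sub_kkt_def sub_F_def zero_prod_def xt)
  have "0 \<le> lam $ j \<and> 0 \<le> s $ j" for j
    using kkt by (cases "j \<in> K") (auto simp: sub_kkt_def coord_space_def less_imp_le)
  then show "lam \<ge> 0" "s \<ge> 0"
    by (simp_all add: less_eq_vec_def)
  have y: "gradient (\<lambda>y'. f (y', x) + (c (y', x) + s) \<bullet> lam + (x - x) \<bullet> eta) y = 0"
    and x: "gradient (\<lambda>x'. f (y, x') + (c (y, x') + s) \<bullet> lam + (x' - x) \<bullet> eta) x = 0"
    using kkt by (auto simp: sub_kkt_def sub_F_def sub_lagrangian_def zero_prod_def xt)
  show "gradient (\<lambda>y'. f (y', x)) y + nabla (\<lambda>y'. c (y', x)) y *v lam = 0"
    using y gradient_lagrangian[OF partial_derivatives(1)[OF f] partial_derivatives(1)[OF c],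
        where s = s and lam = lam and p = 0 and a = 0]
    by simp
  show "gradient (\<lambda>x'. f (y, x')) x + nabla (\<lambda>x'. c (y, x')) x *v lam = - eta"
    using x gradient_lagrangian[OF partial_derivatives(2)[OF f] partial_derivatives(2)[OF c],
        where s = s and lam = lam and p = x and a = eta]
    by (simp add: eq_neg_iff_add_eq_0)
qed

section \<open>Passing to the limit\<close>

lemma coord_space_limit:
  assumes "\<And>n. w n \<in> coord_space A" "w \<longlonglongrightarrow> wl"
  shows "wl \<in> coord_space A"
  unfolding coord_space_def
proof (clarify)
  fix j
  assume "j \<notin> A"
  then have "(\<lambda>n. w n $ j) = (\<lambda>n. 0)"
    using assms(1) by (auto simp: coord_space_def)
  then show "wl $ j = 0"
    using tendsto_vec_nth[OF assms(2), of j] by (simp add: LIMSEQ_const_iff)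
qed

lemma nonneg_limit_vec:
  fixes w :: "nat \<Rightarrow> real^'a::finite"
  assumes "\<And>n. w n \<ge> 0" "w \<longlonglongrightarrow> wl"
  shows "wl \<ge> 0"
proof -
  have "0 \<le> wl $ j" for j
    using assms(1) by (intro LIMSEQ_le_const[OF tendsto_vec_nth[OF assms(2)]])
      (auto simp: less_eq_vec_def)
  then show ?thesis
    by (simp add: less_eq_vec_def)
qed

text \<open>
  The inequality constraints of both stages are treated alike: a slack that is nonnegative,
  asymptotically consistent with the constraint, and asymptotically complementary to the
  multiplier, yields feasibility and exact complementarity in the limit.
\<close>

lemma feasibility_complementarity_limit:
  fixes w :: "nat \<Rightarrow> real^'a::finite"
  assumes g: "g \<longlonglongrightarrow> gl" and s: "s \<longlonglongrightarrow> sl" and w: "w \<longlonglongrightarrow> wl"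
    and slack: "(\<lambda>n. g n + s n) \<longlonglongrightarrow> 0" and compl: "(\<lambda>n. s n * w n) \<longlonglongrightarrow> 0"
    and "\<And>n. s n \<ge> 0"
  shows "gl \<le> 0" "gl * wl = 0"
proof -
  have "gl + sl = 0"
    using LIMSEQ_unique[OF tendsto_add[OF g s] slack] .
  then have gl: "gl = - sl"
    by (simp add: eq_neg_iff_add_eq_0)
  have "sl \<ge> 0"
    using nonneg_limit_vec[OF assms(6) s] .
  then show "gl \<le> 0"
    by (simp add: gl less_eq_vec_def)
  have "sl $ j * wl $ j = 0" for j
    using LIMSEQ_unique[OF tendsto_mult[OF tendsto_vec_nth[OF s, of j] tendsto_vec_nth[OF w, of j]]]
      tendsto_vec_nth[OF compl, of j] by simp
  then show "gl * wl = 0"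
    by (simp add: gl vec_eq_iff)
qed

text \<open>
  The last conclusion identifies the limit of the reported gradients; this is what the first stage
  needs from the subproblems.
\<close>

lemma sub_kkt_limit:
  fixes f :: "(real^'y::finite) \<times> (real^'x::finite) \<Rightarrow> real"
    and c :: "(real^'y) \<times> (real^'x) \<Rightarrow> real^'m::finite"
  assumes kkt: "\<And>n. sub_kkt J K f c (x n) (\<mu> n) (v n)"
    and x: "x \<longlonglongrightarrow> xl" and \<mu>: "\<mu> \<longlonglongrightarrow> 0" and v: "v \<longlonglongrightarrow> (yl, xtl, sl, laml, etal)"
    and "C2_lipschitz f" "C2_lipschitz c"
  shows "yl \<in> coord_space J" "laml \<in> coord_space K" "laml \<ge> 0"
    and "c (yl, xl) \<le> 0" "c (yl, xl) * laml = 0"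
    and "gradient (\<lambda>y'. f (y', xl)) yl + nabla (\<lambda>y'. c (y', xl)) yl *v laml = 0"
    and "gradient (\<lambda>x'. f (yl, x')) xl + nabla (\<lambda>x'. c (yl, x')) xl *v laml = - etal"
proof -
  obtain f' where f: "\<And>z. (f has_derivative blinfun_apply (f' z)) (at z)" "\<And>z. isCont f' z"
    using C2_lipschitz_imp_C1[OF assms(5)] by metis
  obtain c' where c: "\<And>z. (c has_derivative blinfun_apply (c' z)) (at z)" "\<And>z. isCont c' z"
    using C2_lipschitz_imp_C1[OF assms(6)] by metis
  define y xt s lam eta where
    "y = (\<lambda>n. fst (v n))" and "xt = (\<lambda>n. fst (snd (v n)))" and "s = (\<lambda>n. fst (snd (snd (v n))))"
    and "lam = (\<lambda>n. fst (snd (snd (snd (v n)))))"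
    and "eta = (\<lambda>n. snd (snd (snd (snd (v n)))))"
  note comps = y_def xt_def s_def lam_def eta_def
  have lims: "y \<longlonglongrightarrow> yl" "s \<longlonglongrightarrow> sl" "lam \<longlonglongrightarrow> laml" "eta \<longlonglongrightarrow> etal"
    unfolding comps
    using tendsto_fst[OF v] tendsto_fst[OF tendsto_snd[OF tendsto_snd[OF v]]]
      tendsto_fst[OF tendsto_snd[OF tendsto_snd[OF tendsto_snd[OF v]]]]
      tendsto_snd[OF tendsto_snd[OF tendsto_snd[OF tendsto_snd[OF v]]]]
    by simp_all
  have "sub_kkt J K f c (x n) (\<mu> n) (y n, xt n, s n, lam n, eta n)" for n
    using kkt[of n] by (simp add: comps)
  note system = sub_kkt_system[OF this f(1) c(1)]
  show "yl \<in> coord_space J" "laml \<in> coord_space K" "laml \<ge> 0"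
    using coord_space_limit system(1,2) nonneg_limit_vec system(3) lims by blast+
  have z: "(\<lambda>n. (y n, x n)) \<longlonglongrightarrow> (yl, xl)"
    using lims(1) x by (rule tendsto_Pair)
  have "(\<lambda>n. c (y n, x n)) \<longlonglongrightarrow> c (yl, xl)"
    using isCont_tendsto_compose[OF has_derivative_continuous[OF c(1)] z] .
  moreover have "(\<lambda>n. s n * lam n) \<longlonglongrightarrow> 0"
    using tendsto_scaleR[OF \<mu> tendsto_const] by (simp add: system(6))
  ultimately show "c (yl, xl) \<le> 0" "c (yl, xl) * laml = 0"
    using feasibility_complementarity_limit[OF _ lims(2,3)] system(4,5) by simp_all
  have derivs: "(\<lambda>n. f' (y n, x n) d) \<longlonglongrightarrow> f' (yl, xl) d"
    "(\<lambda>n. c' (y n, x n) d) \<longlonglongrightarrow> c' (yl, xl) d" for d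
    by (intro blinfun.tendsto tendsto_const isCont_tendsto_compose[OF f(2) z]
        isCont_tendsto_compose[OF c(2) z])+
  have "(\<lambda>n. gradient (\<lambda>y'. f (y', x n)) (y n) + nabla (\<lambda>y'. c (y', x n)) (y n) *v lam n)
      \<longlonglongrightarrow> gradient (\<lambda>y'. f (y', xl)) yl + nabla (\<lambda>y'. c (y', xl)) yl *v laml"
    by (intro tendsto_add gradient_tendsto nabla_mult_tendsto)
      (rule partial_derivatives(1)[OF f(1)] partial_derivatives(1)[OF c(1)] derivs lims)+
  then show "gradient (\<lambda>y'. f (y', xl)) yl + nabla (\<lambda>y'. c (y', xl)) yl *v laml = 0"
    by (simp add: system(7) LIMSEQ_const_iff)
  have "(\<lambda>n. gradient (\<lambda>x'. f (y n, x')) (x n) + nabla (\<lambda>x'. c (y n, x')) (x n) *v lam n)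
      \<longlonglongrightarrow> gradient (\<lambda>x'. f (yl, x')) xl + nabla (\<lambda>x'. c (yl, x')) xl *v laml"
    by (intro tendsto_add gradient_tendsto nabla_mult_tendsto)
      (rule partial_derivatives(2)[OF f(1)] partial_derivatives(2)[OF c(1)] derivs lims)+
  then show "gradient (\<lambda>x'. f (yl, x')) xl + nabla (\<lambda>x'. c (yl, x')) xl *v laml = - etal"
    using LIMSEQ_unique tendsto_minus[OF lims(4)] by (simp add: system(8))
qed

theorem theorem5p12:
  fixes J :: "'i::finite \<Rightarrow> 'y::finite set"
    and K :: "'i \<Rightarrow> 'm::finite set"
    and f0 :: "real^'x::finite \<Rightarrow> real"
    and c0 :: "real^'x \<Rightarrow> real^'k::finite"
    and f :: "'i \<Rightarrow> (real^'y) \<times> (real^'x) \<Rightarrow> real"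
    and c :: "'i \<Rightarrow> (real^'y) \<times> (real^'x) \<Rightarrow> real^'m"
    and S :: "'i \<Rightarrow> real^'x \<Rightarrow> real \<Rightarrow> ('y, 'x, 'm) subvar"
    and FS :: "('x, 'k) firstvar \<Rightarrow> real \<Rightarrow> ('x, 'k) firstvar"
    and cbar :: real
    and \<mu> :: "nat \<Rightarrow> real"
    and ut u :: "nat \<Rightarrow> ('x, 'k) firstvar"
    and sent :: "nat \<Rightarrow> (real^'x) set"
    and v :: "nat \<Rightarrow> ('y, 'x, 'm) subvar ^ 'i"
    and xstar :: "real^'x"
    and s0star lam0star :: "real^'k"
    and vstar :: "('y, 'x, 'm) subvar ^ 'i"
  assumes dimensions: "\<And>i. subproblem_functions (J i) (K i) (f i) (c i)"
    and regularity0: "C1_lipschitz f0" "C1_lipschitz c0"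
    and regularity: "\<And>i. C2_lipschitz (f i)" "\<And>i. C2_lipschitz (c i)"
    and run: "two_stage_run f0 c0 S FS cbar \<mu> ut sent u v"
    and feasibility: "\<And>l x i. x \<in> sent l \<Longrightarrow>
      sub_feasible (J i) (c i) x \<and> sub_kkt (J i) (K i) (f i) (c i) x (\<mu> l) (S i x (\<mu> l))"
    and limit: "is_limit_point (\<lambda>l. (u l, v l)) ((xstar, s0star, lam0star), vstar)"
  shows "undecomposed_kkt J K f0 c0 f c xstar (\<lambda>i. fst (vstar $ i))"
proof -
  obtain r where r: "strict_mono r"
    and uv: "((\<lambda>l. (u l, v l)) \<circ> r) \<longlonglongrightarrow> ((xstar, s0star, lam0star), vstar)"
    using limit unfolding is_limit_point_def by blast
  define x s0 lam0 m where "x = (\<lambda>n. fst (u (r n)))" and "s0 = (\<lambda>n. fst (snd (u (r n))))"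
    and "lam0 = (\<lambda>n. snd (snd (u (r n))))" and "m = (\<lambda>n. \<mu> (r n))"
  note comps = x_def s0_def lam0_def m_def
  have u: "u (r n) = (x n, s0 n, lam0 n)" for n
    by (simp add: comps)
  have ulim: "(\<lambda>n. u (r n)) \<longlonglongrightarrow> (xstar, s0star, lam0star)"
    and vlim: "(\<lambda>n. v (r n)) \<longlonglongrightarrow> vstar"
    using tendsto_fst[OF uv] tendsto_snd[OF uv] by (simp_all add: comp_def)
  have lims: "x \<longlonglongrightarrow> xstar" "s0 \<longlonglongrightarrow> s0star" "lam0 \<longlonglongrightarrow> lam0star"
    unfolding comps
    using tendsto_fst[OF ulim] tendsto_fst[OF tendsto_snd[OF ulim]]
      tendsto_snd[OF tendsto_snd[OF ulim]] by simp_all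
  have m: "m \<longlonglongrightarrow> 0"
    using LIMSEQ_subseq_LIMSEQ[OF _ r] run by (auto simp: two_stage_run_def m_def comp_def)
  have step: "s0 n \<ge> 0" "lam0 n \<ge> 0" "x n \<in> sent (r n)" "\<And>i. v (r n) $ i = S i (x n) (m n)"
    "norm (first_F f0 c0 S (u (r n)) (m n)) \<le> cbar * m n" for n
  proof -
    \<comment> \<open>The part of a run that concerns iteration \<open>r n\<close>.\<close>
    note run[unfolded two_stage_run_def, THEN conjunct2, THEN conjunct2, THEN conjunct2,
        THEN conjunct2, THEN spec, of "r n", THEN conjunct2]
    then show "s0 n \<ge> 0" "lam0 n \<ge> 0" "x n \<in> sent (r n)"
      "\<And>i. v (r n) $ i = S i (x n) (m n)"
      "norm (first_F f0 c0 S (u (r n)) (m n)) \<le> cbar * m n"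
      by (simp_all add: u m_def first_theta_def)
  qed

  define y xt s lam eta where "y = (\<lambda>i. fst (vstar $ i))" and "xt = (\<lambda>i. fst (snd (vstar $ i)))"
    and "s = (\<lambda>i. fst (snd (snd (vstar $ i))))"
    and "lam = (\<lambda>i. fst (snd (snd (snd (vstar $ i)))))"
    and "eta = (\<lambda>i. snd (snd (snd (snd (vstar $ i)))))"
  have vi: "(\<lambda>n. S i (x n) (m n)) \<longlonglongrightarrow> (y i, xt i, s i, lam i, eta i)" for i
    using tendsto_vec_nth[OF vlim, of i]
    by (simp add: step y_def xt_def s_def lam_def eta_def)
  have "sub_kkt (J i) (K i) (f i) (c i) (x n) (m n) (S i (x n) (m n))" for i n
    using feasibility[OF step(3)] by (simp add: m_def)
  note sub = sub_kkt_limit[OF this lims(1) m vi regularity]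

  have "(\<lambda>n. first_F f0 c0 S (u (r n)) (m n)) \<longlonglongrightarrow> 0"
  proof (rule Lim_null_comparison)
    show "(\<lambda>n. cbar * m n) \<longlonglongrightarrow> 0"
      using tendsto_mult_right_zero[OF m] .
  qed (simp add: step)
  from tendsto_fst[OF this] tendsto_fst[OF tendsto_snd[OF this]] tendsto_snd[OF tendsto_snd[OF this]]
  have first:
    "(\<lambda>n. gradient f0 (x n) + (\<Sum>i\<in>UNIV. reported_gradient (S i) (x n) (m n))
        + nabla c0 (x n) *v lam0 n) \<longlonglongrightarrow> 0"
    "(\<lambda>n. c0 (x n) + s0 n) \<longlonglongrightarrow> 0" "(\<lambda>n. s0 n * lam0 n) \<longlonglongrightarrow> 0"
    by (simp_all add: first_F_def u)

  obtain f0' where f0: "\<And>z. (f0 has_derivative blinfun_apply (f0' z)) (at z)" "\<And>z. isCont f0' z"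
    using C1_lipschitz_imp_C1[OF regularity0(1)] by metis
  obtain c0' where c0: "\<And>z. (c0 has_derivative blinfun_apply (c0' z)) (at z)" "\<And>z. isCont c0' z"
    using C1_lipschitz_imp_C1[OF regularity0(2)] by metis
  have "(\<lambda>n. c0 (x n)) \<longlonglongrightarrow> c0 xstar"
    using isCont_tendsto_compose[OF has_derivative_continuous[OF c0(1)] lims(1)] .
  note first_constraints = feasibility_complementarity_limit[OF this lims(2,3) first(2,3) step(1)]
  have derivs: "(\<lambda>n. f0' (x n) d) \<longlonglongrightarrow> f0' xstar d" "(\<lambda>n. c0' (x n) d) \<longlonglongrightarrow> c0' xstar d" for d
    by (intro blinfun.tendsto tendsto_const isCont_tendsto_compose[OF f0(2) lims(1)]
        isCont_tendsto_compose[OF c0(2) lims(1)])+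
  have rep: "(\<lambda>n. reported_gradient (S i) (x n) (m n)) \<longlonglongrightarrow> - eta i" for i
    using tendsto_minus[OF tendsto_snd[OF tendsto_snd[OF tendsto_snd[OF tendsto_snd[OF vi]]]]]
    by (simp add: reported_gradient_def case_prod_beta)
  have "(\<lambda>n. gradient f0 (x n) + (\<Sum>i\<in>UNIV. reported_gradient (S i) (x n) (m n))
        + nabla c0 (x n) *v lam0 n)
      \<longlonglongrightarrow> gradient f0 xstar + (\<Sum>i\<in>UNIV. - eta i) + nabla c0 xstar *v lam0star"
    by (intro tendsto_add tendsto_sum gradient_tendsto nabla_mult_tendsto)
      (rule f0(1) c0(1) derivs lims rep)+
  then have "gradient f0 xstar + (\<Sum>i\<in>UNIV. - eta i) + nabla c0 xstar *v lam0star = 0"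
    using LIMSEQ_unique first(1) by blast
  \<comment> \<open>The limits of the reported gradients are the missing Lagrangian gradients in \<open>x\<close>.\<close>
  then have stationary: "gradient f0 xstar + nabla c0 xstar *v lam0star
      + (\<Sum>i\<in>UNIV. gradient (\<lambda>x'. f i (y i, x')) xstar
          + nabla (\<lambda>x'. c i (y i, x')) xstar *v lam i) = 0"
    by (simp only: sub(7)) (simp add: algebra_simps)
  have "lam0star \<ge> 0"
    using nonneg_limit_vec[OF step(2) lims(3)] .
  then have "undecomposed_kkt J K f0 c0 f c xstar y"
    unfolding undecomposed_kkt_def
    by (intro conjI allI exI[of _ lam0star] exI[of _ lam])
      (rule sub first_constraints stationary \<open>lam0star \<ge> 0\<close>)+
  then show ?thesis
    by (simp add: y_def)
qed

end
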